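(* For $n\ge1$ we have $$\frac1zX_n=a_nX_{-n-1}+b_nX_n+c_nX_{-n},$$ where $$a_n=\frac{(1-t_1t_2q^n)(1-t_1t_3q^n)(1-t_1t_4q^n)}{t_1(1-t_3t_4q^n)(1-t_1t_2t_3t_4q^{2n})},$$ $$b_n=\frac{\big(-t_1-t_2+t_1t_2(t_3+t_4)q^n\big)\big(1-t_1t_2t_3t_4q^{2n-1}\big)}{\big(-1-t_1t_2+t_1t_2t_3t_4q^{n-1}+t_1t_2q^n\big)\big(1-t_1t_2t_3t_4q^{2n}\big)},$$ $$c_n=-\frac{(1-q^n)(1-t_1t_2q^n)\big(-t_1-t_2+t_1t_2(t_3+t_4)q^n\big)}{\big(-1-t_1t_2+t_1t_2t_3t_4q^{n-1}+t_1t_2q^n\big)\big(1-t_1t_2t_3t_4q^{2n}\big)}.$$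
   Context: Standing assumptions: $0<q<1$; $\mathbf t=(t_1,t_2,t_3,t_4)$ with each $t_i$ real and $|t_i|<1$. Notation: $(a;q)_k=\prod_{i=0}^{k-1}(1-aq^i)$, $(a_1,\dots,a_r;q)_k=\prod_j(a_j;q)_k$, and ${}_4\phi_3(a_1,a_2,a_3,a_4;b_1,b_2,b_3;q,q)=\sum_{k\ge 0}\frac{(a_1,a_2,a_3,a_4;q)_k}{(q,b_1,b_2,b_3;q)_k}q^k$. $R_n={}_4\phi_3(q^{-n},t_1t_2t_3t_4q^{n-1},t_1z,t_1/z;\;t_1t_2,t_1t_3,t_1t_4;q,q)$ for $n\ge0$; $S_0=0$ and for $n\ge1$, $S_n=z(1-t_3/z)(1-t_4/z)\;{}_4\phi_3(q^{1-n},t_1t_2t_3t_4q^{n},t_1z,qt_1/z;\;qt_1t_2,qt_1t_3,qt_1t_4;q,q)$. These are Laurent polynomials in $z$. Define the Laurent polynomials $X_{-n}=(1-t_1t_2)(1-t_1t_3)(1-t_1t_4)R_n-t_1(1-t_1t_2t_3t_4q^{n-1})S_n$ for $n>0$, $X_{n}=(1-t_1t_2)(1-t_1t_3)(1-t_1t_4)R_n+t_1^2t_2(1-q^{n})S_n$ for $n\ge0$. *)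

theory Defs
  imports "HOL-Computational_Algebra.Formal_Laurent_Series"
begin

definition qpochhammer :: "'a::comm_ring_1 \<Rightarrow> 'a \<Rightarrow> nat \<Rightarrow> 'a"
  where "qpochhammer a q k = (\<Prod>i<k. 1 - a * q ^ i)"

definition qpochhammer_list :: "'a::comm_ring_1 list \<Rightarrow> 'a \<Rightarrow> nat \<Rightarrow> 'a"
  where "qpochhammer_list as q k = (\<Prod>a\<leftarrow>as. qpochhammer a q k)"

text \<open>The series \<open>\<^sub>4\<phi>\<^sub>3(a\<^sub>1, a\<^sub>2, a\<^sub>3, a\<^sub>4; b\<^sub>1, b\<^sub>2, b\<^sub>3; q, q)\<close>. All its uses below
  terminate, since one of the \<open>a\<^sub>i\<close> is \<open>q\<^sup>-\<^sup>m\<close> for a natural number \<open>m\<close>.\<close>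

definition phi43 ::
  "'a \<Rightarrow> 'a \<Rightarrow> 'a \<Rightarrow> 'a \<Rightarrow> 'a \<Rightarrow> 'a \<Rightarrow> 'a \<Rightarrow> 'a \<Rightarrow> 'a::{field, topological_space}"
  where "phi43 a1 a2 a3 a4 b1 b2 b3 q =
    (\<Sum>k. qpochhammer_list [a1, a2, a3, a4] q k / qpochhammer_list [q, b1, b2, b3] q k * q ^ k)"

text \<open>Laurent polynomials in \<open>z\<close> are represented in the field \<^typ>\<open>real fls\<close> of formal
  Laurent series, with \<open>z\<close> being \<^const>\<open>fls_X\<close> and scalars embedded by \<^const>\<open>fls_const\<close>.\<close>

definition AW_R :: "real \<Rightarrow> real \<Rightarrow> real \<Rightarrow> real \<Rightarrow> real \<Rightarrow> nat \<Rightarrow> real fls"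
  where "AW_R q t1 t2 t3 t4 n =
    phi43
      (fls_const (q powi (- int n)))
      (fls_const (t1 * t2 * t3 * t4 * q powi (int n - 1)))
      (fls_const t1 * fls_X)
      (fls_const t1 / fls_X)
      (fls_const (t1 * t2)) (fls_const (t1 * t3)) (fls_const (t1 * t4))
      (fls_const q)"

definition AW_S :: "real \<Rightarrow> real \<Rightarrow> real \<Rightarrow> real \<Rightarrow> real \<Rightarrow> nat \<Rightarrow> real fls"
  where "AW_S q t1 t2 t3 t4 n =
    (if n = 0 then 0
     else fls_X * (1 - fls_const t3 / fls_X) * (1 - fls_const t4 / fls_X) *
       phi43
         (fls_const (q powi (1 - int n)))
         (fls_const (t1 * t2 * t3 * t4 * q ^ n))
         (fls_const t1 * fls_X)
         (fls_const (q * t1) / fls_X)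
         (fls_const (q * t1 * t2)) (fls_const (q * t1 * t3)) (fls_const (q * t1 * t4))
         (fls_const q))"

text \<open>The index is an integer \<open>m\<close>; here \<open>n = \<bar>m\<bar>\<close>, and \<open>n - 1\<close> (truncated subtraction) occurs
  only when \<open>n \<ge> 1\<close>.\<close>

definition AW_X :: "real \<Rightarrow> real \<Rightarrow> real \<Rightarrow> real \<Rightarrow> real \<Rightarrow> int \<Rightarrow> real fls"
  where "AW_X q t1 t2 t3 t4 m =
    (let n = nat \<bar>m\<bar>;
         R = AW_R q t1 t2 t3 t4 n;
         S = AW_S q t1 t2 t3 t4 n;
         \<kappa> = (1 - t1 * t2) * (1 - t1 * t3) * (1 - t1 * t4)
     in if m < 0
        then fls_const \<kappa> * R - fls_const (t1 * (1 - t1 * t2 * t3 * t4 * q ^ (n - 1))) * S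
        else fls_const \<kappa> * R + fls_const (t1\<^sup>2 * t2 * (1 - q ^ n)) * S)"

definition coeff_a :: "real \<Rightarrow> real \<Rightarrow> real \<Rightarrow> real \<Rightarrow> real \<Rightarrow> nat \<Rightarrow> real"
  where "coeff_a q t1 t2 t3 t4 n =
    ((1 - t1 * t2 * q ^ n) * (1 - t1 * t3 * q ^ n) * (1 - t1 * t4 * q ^ n)) /
    (t1 * (1 - t3 * t4 * q ^ n) * (1 - t1 * t2 * t3 * t4 * q ^ (2 * n)))"

definition coeff_b :: "real \<Rightarrow> real \<Rightarrow> real \<Rightarrow> real \<Rightarrow> real \<Rightarrow> nat \<Rightarrow> real"
  where "coeff_b q t1 t2 t3 t4 n =
    ((- t1 - t2 + t1 * t2 * (t3 + t4) * q ^ n) * (1 - t1 * t2 * t3 * t4 * q ^ (2 * n - 1))) /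
    ((- 1 - t1 * t2 + t1 * t2 * t3 * t4 * q ^ (n - 1) + t1 * t2 * q ^ n) *
     (1 - t1 * t2 * t3 * t4 * q ^ (2 * n)))"

definition coeff_c :: "real \<Rightarrow> real \<Rightarrow> real \<Rightarrow> real \<Rightarrow> real \<Rightarrow> nat \<Rightarrow> real"
  where "coeff_c q t1 t2 t3 t4 n =
    - (((1 - q ^ n) * (1 - t1 * t2 * q ^ n) * (- t1 - t2 + t1 * t2 * (t3 + t4) * q ^ n)) /
       ((- 1 - t1 * t2 + t1 * t2 * t3 * t4 * q ^ (n - 1) + t1 * t2 * q ^ n) *
        (1 - t1 * t2 * t3 * t4 * q ^ (2 * n))))"

end

theory Submission
  imports Defs
begin

text \<open>
  Write \<open>T = t\<^sub>1t\<^sub>2t\<^sub>3t\<^sub>4\<close> and \<open>Q = q\<^sup>n\<close>. In \<open>b\<^sub>n X\<^sub>n + c\<^sub>n X\<^sub>-\<^sub>n\<close> the quadratic denominator factor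
  cancels, and after clearing denominators the claim is a linear relation between
  \<open>R\<^sub>n\<close>, \<open>S\<^sub>n\<close>, \<open>R\<^sub>n\<^sub>+\<^sub>1\<close> and \<open>S\<^sub>n\<^sub>+\<^sub>1\<close>. Pairing the term of index \<open>k + 1\<close> of the \<open>R\<close>-series with the
  term of index \<open>k\<close> of the \<open>S\<close>-series, all terms acquire the common factor
  \<open>w\<^sub>k = (1/Q, TQ, t\<^sub>1z, qt\<^sub>1/z; q)\<^sub>k q\<^sup>k / (q, qt\<^sub>1t\<^sub>2, qt\<^sub>1t\<^sub>3, qt\<^sub>1t\<^sub>4; q)\<^sub>k\<close>.
  The partial sums then have a closed form: up to a factor independent of \<open>k\<close>, they are
  \<open>w\<^sub>k q\<^sup>-\<^sup>k (1 - t\<^sub>1t\<^sub>2q\<^sup>k)(1 - t\<^sub>1t\<^sub>3q\<^sup>k)(1 - t\<^sub>1t\<^sub>4q\<^sup>k)\<close>, which vanishes for \<open>k = n + 1\<close>.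
\<close>

section \<open>Terminating q-series\<close>

lemma qpochhammer_0 [simp]: "qpochhammer a q 0 = 1"
  by (simp add: qpochhammer_def)

lemma qpochhammer_Suc: "qpochhammer a q (Suc k) = qpochhammer a q k * (1 - a * q ^ k)"
  by (simp add: qpochhammer_def)

lemma qpochhammer_Suc_shift: "qpochhammer a q (Suc k) = (1 - a) * qpochhammer (q * a) q k"
  unfolding qpochhammer_def by (subst prod.lessThan_Suc_shift) (simp add: mult_ac)

lemma qpochhammer_eq_0_iff:
  fixes a q :: "'a::idom"
  shows "qpochhammer a q k = 0 \<longleftrightarrow> (\<exists>i<k. a * q ^ i = 1)"
  by (auto simp: qpochhammer_def)

text \<open>A vanishing factor of the first numerator symbol persists in all longer products. The
  bound \<open>m\<close> need not be minimal, so series of different lengths can be padded with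
  zeros to a common range.\<close>

lemma phi43_terminating:
  fixes a1 a2 a3 a4 b1 b2 b3 q :: "'a::{field,t2_space}"
  assumes "qpochhammer a1 q m = 0"
  shows "phi43 a1 a2 a3 a4 b1 b2 b3 q =
    (\<Sum>k<m. qpochhammer a1 q k * qpochhammer a2 q k * qpochhammer a3 q k * qpochhammer a4 q k /
      (qpochhammer q q k * qpochhammer b1 q k * qpochhammer b2 q k * qpochhammer b3 q k) * q ^ k)"
proof -
  have "qpochhammer a1 q k = 0" if "k \<ge> m" for k
    using assms that by (force simp: qpochhammer_eq_0_iff)
  then show ?thesis
    unfolding phi43_def by (subst suminf_finite[of "{..<m}"]) (auto simp: qpochhammer_list_def mult_ac)
qed

section \<open>The partial sums\<close>

text \<open>\<open>Q\<close> stands for q^n but is a free parameter: the closed form of the partial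
  sums holds for every nonzero \<open>Q\<close>, and only the vanishing at the upper end needs Q =
  q^n.\<close>

definition weight :: "'a \<Rightarrow> 'a \<Rightarrow> 'a \<Rightarrow> 'a \<Rightarrow> 'a \<Rightarrow> 'a \<Rightarrow> 'a \<Rightarrow> nat \<Rightarrow> 'a::field"
  where "weight q Q t1 t2 t3 t4 z k =
    qpochhammer (1/Q) q k * qpochhammer (t1*t2*t3*t4*Q) q k *
    qpochhammer (t1*z) q k * qpochhammer (q*t1/z) q k /
    (qpochhammer q q k * qpochhammer (q*t1*t2) q k * qpochhammer (q*t1*t3) q k *
     qpochhammer (q*t1*t4) q k) * q ^ k"

lemma weight_0 [simp]: "weight q Q t1 t2 t3 t4 z 0 = 1"
  by (simp add: weight_def)

lemma weight_Suc:
  "weight q Q t1 t2 t3 t4 z (Suc k) = weight q Q t1 t2 t3 t4 z k *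
    ((1 - q^k/Q) * (1 - t1*t2*t3*t4*Q*q^k) * (1 - t1*z*q^k) * (1 - q*q^k*t1/z) * q /
     ((1 - q*q^k) * (1 - t1*t2*(q*q^k)) * (1 - t1*t3*(q*q^k)) * (1 - t1*t4*(q*q^k))))"
  by (simp add: weight_def qpochhammer_Suc mult_ac)

text \<open>The telescoping identity below after multiplication by \<open>(1-q*K)*K*z^2*Q\<close>;
  here \<open>M\<close>, \<open>P\<close> and \<open>Y\<close> are z times their namesakes there. As
  a polynomial identity it is decided by ring normalisation.\<close>

lemma telescoping_identity_poly:
  fixes t1 t2 t3 t4 Q K z q :: "'a::field"
  defines "T \<equiv> t1*t2*t3*t4"
  defines "N \<equiv> (1-t1*t2*Q)*(1-t1*t3*Q)*(1-t1*t4*Q)"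
  defines "F \<equiv> 1 - t3*t4*Q" and "E \<equiv> 1 - T*Q^2"
  defines "B \<equiv> - t1 - t2 + t1*t2*(t3+t4)*Q"
  defines "M \<equiv> (N - t1*B*F*Q)*z - E*F*t1"
  defines "P \<equiv> (1-t1*z*K)*(z-t1)" and "Y \<equiv> (z-t3)*(z-t4)"
  shows "(1-t1*t2*K)*(1-t1*t3*K)*(1-t1*t4*K)*(1-q*K)*M*z*Q + 
     K*((1-T*Q*K)*N*z*((q*Q-1)*P-t1*Y*(1-q*K)*Q)
        - (Q-K)*t1*B*F*Q*z*((q-T*Q)*P-t1*Y*(1-q*K))
        - (Q-K)*E*F*t1*((q-T*Q)*P-t1*(t1*t2)*Q*Y*(1-q*K)))
   = (Q-K)*(1-T*Q*K)*(1-t1*z*K)*(z-q*K*t1)*M"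
  unfolding assms by algebra

text \<open>One telescoping step at K = q^k with the common weight divided out. The right side is
  the quotient of consecutive weights times the closed form at \<open>q*K\<close>, whose cubic
  factor has cancelled.\<close>

lemma telescoping_identity:
  fixes t1 t2 t3 t4 Q K z q :: "'a::field"
  defines "T \<equiv> t1*t2*t3*t4"
  defines "N \<equiv> (1-t1*t2*Q)*(1-t1*t3*Q)*(1-t1*t4*Q)"
  defines "F \<equiv> 1 - t3*t4*Q" and "E \<equiv> 1 - T*Q^2"
  defines "B \<equiv> - t1 - t2 + t1*t2*(t3+t4)*Q"
  defines "M \<equiv> N - t1*B*F*Q - E*F*t1/z"
  defines "P \<equiv> (1-t1*z*K)*(1-t1/z)" and "Y \<equiv> z*(1-t3/z)*(1-t4/z)"
  assumes "z \<noteq> 0" "Q \<noteq> 0" "K \<noteq> 0" "1 - q*K \<noteq> 0"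
  shows "(1-t1*t2*K)*(1-t1*t3*K)*(1-t1*t4*K)*M/K +
     (N*((1-T*Q*K)*(q-1/Q)/(1-q*K)*P - t1*(1-T*Q*K)*Y)
      - t1*B*F*Q*((1-K/Q)*(q-T*Q)/(1-q*K)*P - t1*(1-K/Q)*Y)
      - E*F*t1/z*((1-K/Q)*(q-T*Q)/(1-q*K)*P - t1*(t1*t2)*Q*(1-K/Q)*Y))
   = (1-K/Q)*(1-T*Q*K)*(1-t1*z*K)*(1-q*K*t1/z)*M/((1-q*K)*K)"
    (is "?L = ?R")
proof -
  define P' where "P' = (1-t1*z*K)*(z-t1)"
  define Y' where "Y' = (z-t3)*(z-t4)"
  define M' where "M' = (N - t1*B*F*Q)*z - E*F*t1"
  \<comment> \<open>\<open>A\<close> and \<open>u\<close> stay opaque so that clearing denominators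
    does not expand them.\<close>
  define A where "A = (1-t1*t2*K)*(1-t1*t3*K)*(1-t1*t4*K)"
  define u where "u = 1 - q*K"
  have u: "u \<noteq> 0" using assms(12) by (simp add: u_def)
  have P: "P = P'/z" and Y: "Y = Y'/z" and M: "M = M'/z"
    using \<open>z \<noteq> 0\<close> by (simp_all add: P_def P'_def Y_def Y'_def M_def M'_def field_simps)
  have "?L * (u*K*z^2*Q) = A*u*M'*z*Q + 
     K*((1-T*Q*K)*N*z*((q*Q-1)*P'-t1*Y'*u*Q)
        - (Q-K)*t1*B*F*Q*z*((q-T*Q)*P'-t1*Y'*u)
        - (Q-K)*E*F*t1*((q-T*Q)*P'-t1*(t1*t2)*Q*Y'*u))"
    unfolding P Y M A_def[symmetric] u_def[symmetric] using assms(9-11) u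
    by (simp add: divide_simps) (simp add: algebra_simps power2_eq_square)
  also have "\<dots> = (Q-K)*(1-T*Q*K)*(1-t1*z*K)*(z-q*K*t1)*M'"
    unfolding P'_def Y'_def M'_def A_def u_def N_def F_def E_def B_def T_def
    by (rule telescoping_identity_poly)
  also have "\<dots> = ?R * (u*K*z^2*Q)"
    unfolding M u_def[symmetric] using assms(9-11) u
    by (simp add: divide_simps) (simp add: algebra_simps power2_eq_square)
  finally have "?L * (u*K*z^2*Q) = ?R * (u*K*z^2*Q)" .
  moreover have "u*K*z^2*Q \<noteq> 0" using assms(9-11) u by simp
  ultimately show ?thesis by (metis mult_right_cancel)
qed

text \<open>\<open>h\<close> collects the k-th contributions of the four series to the contiguous
  relation. The starting value, the cubic product at K = 1 times \<open>M\<close>, is the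
  contribution of the index-0 terms of the two R-series.\<close>

lemma weighted_partial_sum:
  fixes q Q t1 t2 t3 t4 z :: "'a::field"
  defines "T \<equiv> t1*t2*t3*t4"
  defines "N \<equiv> (1-t1*t2*Q)*(1-t1*t3*Q)*(1-t1*t4*Q)"
  defines "F \<equiv> 1 - t3*t4*Q" and "E \<equiv> 1 - T*Q^2"
  defines "B \<equiv> - t1 - t2 + t1*t2*(t3+t4)*Q"
  defines "M \<equiv> N - t1*B*F*Q - E*F*t1/z"
  defines "P \<equiv> \<lambda>K. (1-t1*z*K)*(1-t1/z)" and "Y \<equiv> z*(1-t3/z)*(1-t4/z)"
  defines "h \<equiv> \<lambda>K. N*((1-T*Q*K)*(q-1/Q)/(1-q*K)*P K - t1*(1-T*Q*K)*Y)
      - t1*B*F*Q*((1-K/Q)*(q-T*Q)/(1-q*K)*P K - t1*(1-K/Q)*Y)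
      - E*F*t1/z*((1-K/Q)*(q-T*Q)/(1-q*K)*P K - t1*(t1*t2)*Q*(1-K/Q)*Y)"
  assumes "z \<noteq> 0" "Q \<noteq> 0" "q \<noteq> 0"
    and q: "\<And>k. q * q ^ k \<noteq> 1"
    and t: "\<And>k. t1*t2*q^k \<noteq> 1" "\<And>k. t1*t3*q^k \<noteq> 1" "\<And>k. t1*t4*q^k \<noteq> 1"
  shows "(1-t1*t2)*(1-t1*t3)*(1-t1*t4)*M + (\<Sum>k<m. weight q Q t1 t2 t3 t4 z k * h (q^k)) =
    weight q Q t1 t2 t3 t4 z m * ((1-t1*t2*q^m)*(1-t1*t3*q^m)*(1-t1*t4*q^m)*M/q^m)"
proof (induction m)
  case 0
  then show ?case by simp
next
  case (Suc m)
  define K where "K = q^m"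
  have K: "K \<noteq> 0" "1 - q*K \<noteq> 0" using assms(12) q[of m] by (auto simp: K_def)
  have t': "1-t1*t2*(q*K) \<noteq> 0" "1-t1*t3*(q*K) \<noteq> 0" "1-t1*t4*(q*K) \<noteq> 0"
    using t(1)[of "Suc m"] t(2)[of "Suc m"] t(3)[of "Suc m"] by (auto simp: K_def)
  let ?w = "weight q Q t1 t2 t3 t4 z m"
  have "(1-t1*t2)*(1-t1*t3)*(1-t1*t4)*M + (\<Sum>k<Suc m. weight q Q t1 t2 t3 t4 z k * h (q^k)) =
      ?w * ((1-t1*t2*K)*(1-t1*t3*K)*(1-t1*t4*K)*M/K + h K)"
    using Suc.IH by (simp add: K_def algebra_simps)
  also have "(1-t1*t2*K)*(1-t1*t3*K)*(1-t1*t4*K)*M/K + h K =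
      (1-K/Q)*(1-T*Q*K)*(1-t1*z*K)*(1-q*K*t1/z)*M/((1-q*K)*K)"
    unfolding h_def P_def Y_def M_def B_def E_def F_def N_def T_def
    by (rule telescoping_identity) (use assms K in auto)
  also have "?w * \<dots> = weight q Q t1 t2 t3 t4 z (Suc m) *
      ((1-t1*t2*(q*K))*(1-t1*t3*(q*K))*(1-t1*t4*(q*K))*M/(q*K))"
    unfolding weight_Suc K_def[symmetric] T_def[symmetric] using K t' \<open>q \<noteq> 0\<close> by simp
  finally show ?case by (simp add: K_def)
qed

section \<open>The contiguous relation\<close>

text \<open>In the R-series the index-0 term is split off and index k+1 becomes k; each symbol of
  length k+1 loses its first or last factor, whichever leaves the symbol in \<open>weight\<close>,
  and \<kappa> cancels the first factors of the lower symbols. The S-series need only (1-x)(qx;q)_k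
  = (x;q)_k (1-xq^k).\<close>

lemma phi43_as_weighted_sum:
  fixes q Q t1 t2 t3 t4 z :: "'a::{field,t2_space}"
  defines "T \<equiv> t1*t2*t3*t4" and "\<kappa> \<equiv> (1-t1*t2)*(1-t1*t3)*(1-t1*t4)"
  defines "P \<equiv> \<lambda>K. (1-t1*z*K)*(1-t1/z)"
  assumes nz: "z \<noteq> 0" "Q \<noteq> 0" "q \<noteq> 0" "t1*t2 \<noteq> 1" "t1*t3 \<noteq> 1" "t1*t4 \<noteq> 1"
    and Q: "Q = q ^ n"
  shows "\<kappa> * phi43 (1/Q) (T*Q/q) (t1*z) (t1/z) (t1*t2) (t1*t3) (t1*t4) q =
      \<kappa> + (\<Sum>k<Suc n. weight q Q t1 t2 t3 t4 z k * ((1-q^k/Q)*(q-T*Q)/(1-q*q^k)*P (q^k)))"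
    and "\<kappa> * phi43 (1/(q*Q)) (T*Q) (t1*z) (t1/z) (t1*t2) (t1*t3) (t1*t4) q =
      \<kappa> + (\<Sum>k<Suc n. weight q Q t1 t2 t3 t4 z k * ((1-T*Q*q^k)*(q-1/Q)/(1-q*q^k)*P (q^k)))"
    and "n \<ge> 1 \<Longrightarrow>
      (1-1/Q) * phi43 (q/Q) (T*Q) (t1*z) (q*t1/z) (q*t1*t2) (q*t1*t3) (q*t1*t4) q =
      (\<Sum>k<Suc n. weight q Q t1 t2 t3 t4 z k * (1-q^k/Q))"
    and "(1-T*Q) * phi43 (1/Q) (T*(q*Q)) (t1*z) (q*t1/z) (q*t1*t2) (q*t1*t3) (q*t1*t4) q =
      (\<Sum>k<Suc n. weight q Q t1 t2 t3 t4 z k * (1-T*Q*q^k))"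
proof -
  have shift: "qpochhammer x q k * (1 - x * q ^ k) = (1 - x) * qpochhammer (q * x) q k" for x k
    by (metis qpochhammer_Suc qpochhammer_Suc_shift)
  have weight: "weight q Q t1 t2 t3 t4 z k =
    qpochhammer (1/Q) q k * qpochhammer (T*Q) q k * qpochhammer (t1*z) q k * qpochhammer (q*t1/z) q k /
    (qpochhammer q q k * qpochhammer (q*(t1*t2)) q k * qpochhammer (q*(t1*t3)) q k *
     qpochhammer (q*(t1*t4)) q k) * q ^ k" for k
    by (simp add: weight_def T_def mult.assoc)
  have k: "1-t1*t2 \<noteq> 0" "1-t1*t3 \<noteq> 0" "1-t1*t4 \<noteq> 0" using nz by auto
  have cancel: "\<kappa> * (a / (b * ((1-t1*t2)*c1) * ((1-t1*t3)*c2) * ((1-t1*t4)*c3)) * d) =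
      a / (b*c1*c2*c3) * d" for a b c1 c2 c3 d
    using k by (simp add: \<kappa>_def)
  have pull: "x * (a*b*c*d/e*f) = (x*a) * (b*c*d/e*f)" "x * (a*b*c*d/e*f) = (x*b) * (a*c*d/e*f)"
    for x a b c d e f :: 'a
    by simp_all
  \<comment> \<open>The R-series at n and at n+1 are both cut at n+2 terms, so that both give sums
    over k < n+1 after the shift; for the former, the last term is zero.\<close>
  have z1: "qpochhammer (1/Q) q (Suc (Suc n)) = 0" "qpochhammer (1/Q) q (Suc n) = 0"
    unfolding qpochhammer_eq_0_iff using Q nz by (auto intro!: exI[of _ n])
  have z2: "qpochhammer (1/(q*Q)) q (Suc (Suc n)) = 0"
    unfolding qpochhammer_eq_0_iff using Q nz by (auto intro!: exI[of _ "Suc n"])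
  show "\<kappa> * phi43 (1/Q) (T*Q/q) (t1*z) (t1/z) (t1*t2) (t1*t3) (t1*t4) q =
      \<kappa> + (\<Sum>k<Suc n. weight q Q t1 t2 t3 t4 z k * ((1-q^k/Q)*(q-T*Q)/(1-q*q^k)*P (q^k)))"
    unfolding phi43_terminating[OF z1(1)] sum.lessThan_Suc_shift[of _ "Suc n"] distrib_left
      sum_distrib_left
  proof (intro arg_cong2[of _ _ _ _ "(+)"] sum.cong refl, goal_cases)
    case (2 i)
    \<comment> \<open>The factor \<open>q\<close> comes from q^(k+1), and \<open>1 - T*Q/q\<close>
      is the first factor of the second symbol.\<close>
    have "q - T*Q = (1 - T*Q/q) * q" using nz by (simp add: field_simps)
    moreover have "q * (T*Q/q) = T*Q" using nz by simp
    ultimately show ?case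
      unfolding qpochhammer_Suc[of "1/Q"] qpochhammer_Suc_shift[of "T*Q/q"] qpochhammer_Suc[of "t1*z"]
        qpochhammer_Suc_shift[of "t1/z"] qpochhammer_Suc[of q] qpochhammer_Suc_shift[of "t1*t2"]
        qpochhammer_Suc_shift[of "t1*t3"] qpochhammer_Suc_shift[of "t1*t4"] cancel
      by (simp add: weight P_def mult_ac)
  qed simp
  show "\<kappa> * phi43 (1/(q*Q)) (T*Q) (t1*z) (t1/z) (t1*t2) (t1*t3) (t1*t4) q =
      \<kappa> + (\<Sum>k<Suc n. weight q Q t1 t2 t3 t4 z k * ((1-T*Q*q^k)*(q-1/Q)/(1-q*q^k)*P (q^k)))"
    unfolding phi43_terminating[OF z2] sum.lessThan_Suc_shift[of _ "Suc n"] distrib_left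
      sum_distrib_left
  proof (intro arg_cong2[of _ _ _ _ "(+)"] sum.cong refl, goal_cases)
    case (2 i)
    have "q - 1/Q = (1 - 1/(q*Q)) * q" using nz by (simp add: field_simps)
    moreover have "q * (1/(q*Q)) = 1/Q" using nz by simp
    ultimately show ?case
      unfolding qpochhammer_Suc_shift[of "1/(q*Q)"] qpochhammer_Suc[of "T*Q"] qpochhammer_Suc[of "t1*z"]
        qpochhammer_Suc_shift[of "t1/z"] qpochhammer_Suc[of q] qpochhammer_Suc_shift[of "t1*t2"]
        qpochhammer_Suc_shift[of "t1*t3"] qpochhammer_Suc_shift[of "t1*t4"] cancel
      by (simp add: weight P_def mult_ac)
  qed simp
  show "(1-1/Q) * phi43 (q/Q) (T*Q) (t1*z) (q*t1/z) (q*t1*t2) (q*t1*t3) (q*t1*t4) q =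
      (\<Sum>k<Suc n. weight q Q t1 t2 t3 t4 z k * (1-q^k/Q))" if "n \<ge> 1"
  proof -
    \<comment> \<open>Here q/Q = q^(-(n-1)), which terminates the series only because n is at least
      1.\<close>
    have z3: "qpochhammer (q/Q) q (Suc n) = 0"
      unfolding qpochhammer_eq_0_iff using Q nz that
      by (cases n) (auto intro!: exI[of _ "n - 1"])
    show ?thesis
      unfolding phi43_terminating[OF z3] sum_distrib_left
    proof (intro sum.cong refl, goal_cases)
      case (1 k)
      have "(1-1/Q) * qpochhammer (q/Q) q k = qpochhammer (1/Q) q k * (1 - q^k/Q)"
        using shift[of "1/Q" k] by simp
      then show ?case
        unfolding weight pull(1) by (simp add: mult.assoc)
    qed
  qed
  show "(1-T*Q) * phi43 (1/Q) (T*(q*Q)) (t1*z) (q*t1/z) (q*t1*t2) (q*t1*t3) (q*t1*t4) q =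
      (\<Sum>k<Suc n. weight q Q t1 t2 t3 t4 z k * (1-T*Q*q^k))"
    unfolding phi43_terminating[OF z1(2)] sum_distrib_left
  proof (intro sum.cong refl, goal_cases)
    case (1 k)
    have "(1-T*Q) * qpochhammer (T*(q*Q)) q k = qpochhammer (T*Q) q k * (1 - T*Q*q^k)"
      using shift[of "T*Q" k] by (simp add: mult.left_commute)
    then show ?case
      unfolding weight pull(2) by (simp add: mult.assoc)
  qed
qed

text \<open>This is the recurrence times E F, with \<open>Q*\<kappa>*R0 + t1*(1-Q)*S0\<close>
  standing for b_n X_n + c_n X_{-n} up to the factor -B/E. The difference of the two sides is a
  partial sum whose closed form vanishes.\<close>

lemma contiguous_relation:
  fixes q Q t1 t2 t3 t4 z :: "'a::{field,t2_space}"
  defines "T \<equiv> t1*t2*t3*t4" and "\<kappa> \<equiv> (1-t1*t2)*(1-t1*t3)*(1-t1*t4)"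
  defines "N \<equiv> (1-t1*t2*Q)*(1-t1*t3*Q)*(1-t1*t4*Q)"
  defines "F \<equiv> 1 - t3*t4*Q" and "E \<equiv> 1 - T*Q^2"
  defines "B \<equiv> - t1 - t2 + t1*t2*(t3+t4)*Q"
  defines "Y \<equiv> z*(1-t3/z)*(1-t4/z)"
  defines "R0 \<equiv> phi43 (1/Q) (T*Q/q) (t1*z) (t1/z) (t1*t2) (t1*t3) (t1*t4) q"
    and "R1 \<equiv> phi43 (1/(q*Q)) (T*Q) (t1*z) (t1/z) (t1*t2) (t1*t3) (t1*t4) q"
    and "S0 \<equiv> Y * phi43 (q/Q) (T*Q) (t1*z) (q*t1/z) (q*t1*t2) (q*t1*t3) (q*t1*t4) q"
    and "S1 \<equiv> Y * phi43 (1/Q) (T*(q*Q)) (t1*z) (q*t1/z) (q*t1*t2) (q*t1*t3) (q*t1*t4) q"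
  assumes nz: "z \<noteq> 0" "Q \<noteq> 0" "q \<noteq> 0"
    and q: "\<And>k. q * q ^ k \<noteq> 1"
    and t: "\<And>k. t1*t2*q^k \<noteq> 1" "\<And>k. t1*t3*q^k \<noteq> 1" "\<And>k. t1*t4*q^k \<noteq> 1"
    and Q: "Q = q ^ n" and n: "n \<ge> 1"
  shows "E*F*t1/z*(\<kappa>*R0 + t1^2*t2*(1-Q)*S0) =
    N*(\<kappa>*R1 - t1*(1-T*Q)*S1) - t1*B*F*(Q*\<kappa>*R0 + t1*(1-Q)*S0)"
proof -
  define M where "M = N - t1*B*F*Q - E*F*t1/z"
  define P where "P = (\<lambda>K. (1-t1*z*K)*(1-t1/z))"
  define w where "w = weight q Q t1 t2 t3 t4 z"
  define f1 where "f1 = (\<lambda>k. (1-q^k/Q)*(q-T*Q)/(1-q*q^k)*P (q^k))"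
  define f2 where "f2 = (\<lambda>k. (1-T*Q*q^k)*(q-1/Q)/(1-q*q^k)*P (q^k))"
  define f3 where "f3 = (\<lambda>k. 1-q^k/Q)"
  define f4 where "f4 = (\<lambda>k. 1-T*Q*q^k)"
  define s where "s = (\<lambda>f. \<Sum>k<Suc n. w k * f k)"
  have t0: "t1*t2 \<noteq> 1" "t1*t3 \<noteq> 1" "t1*t4 \<noteq> 1" using t[of 0] by simp_all
  note sums = phi43_as_weighted_sum[OF nz t0 Q, folded T_def]
  have R0: "\<kappa>*R0 = \<kappa> + s f1"
    using sums(1) unfolding R0_def \<kappa>_def s_def f1_def P_def w_def .
  have R1: "\<kappa>*R1 = \<kappa> + s f2"
    using sums(2) unfolding R1_def \<kappa>_def s_def f2_def P_def w_def .
  have "(1-1/Q)*S0 = Y * s f3"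
    unfolding S0_def s_def f3_def w_def mult.left_commute[of "1-1/Q" Y] sums(3)[OF n] ..
  \<comment> \<open>The series identity supplies \<open>1-1/Q\<close> where the relation has
    \<open>1-Q\<close>; the conversion produces the extra \<open>Q\<close> in the S-terms of the
    summand.\<close>
  moreover have "1 - Q = - Q * (1 - 1/Q)" using nz by (simp add: field_simps)
  ultimately have S0: "(1-Q)*S0 = - Q * Y * s f3" by simp
  have S1: "(1-T*Q)*S1 = Y * s f4"
    unfolding S1_def s_def f4_def w_def mult.left_commute[of "1-T*Q" Y] sums(4) ..
  \<comment> \<open>The last factor of (1/Q;q)_(n+1) is 1 - q^n/Q = 0.\<close>
  have "weight q Q t1 t2 t3 t4 z (Suc n) = 0"
    by (simp add: weight_Suc Q nz)
  then have "\<kappa>*M + (\<Sum>k<Suc n. w k * (N*(f2 k - t1*f4 k*Y) - t1*B*F*Q*(f1 k - t1*f3 k*Y)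
      - E*F*t1/z*(f1 k - t1*(t1*t2)*Q*f3 k*Y))) = 0"
    using weighted_partial_sum[OF nz q t, where m = "Suc n"]
    unfolding \<kappa>_def M_def N_def B_def F_def E_def T_def w_def f1_def f2_def f3_def f4_def P_def Y_def
    by simp
  moreover have "(\<Sum>k<Suc n. w k * (N*(f2 k - t1*f4 k*Y) - t1*B*F*Q*(f1 k - t1*f3 k*Y)
      - E*F*t1/z*(f1 k - t1*(t1*t2)*Q*f3 k*Y))) =
      N*(s f2 - t1*Y*s f4) - t1*B*F*Q*(s f1 - t1*Y*s f3) - E*F*t1/z*(s f1 - t1*(t1*t2)*Q*Y*s f3)"
    unfolding s_def sum_distrib_left sum_subtractf[symmetric]
    by (intro sum.cong refl) (simp add: algebra_simps)
  ultimately have main: "\<kappa>*M + (N*(s f2 - t1*Y*s f4) - t1*B*F*Q*(s f1 - t1*Y*s f3)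
      - E*F*t1/z*(s f1 - t1*(t1*t2)*Q*Y*s f3)) = 0" by simp
  obtain g where g: "E*F*t1/z = g" by blast
  have "E*F*t1/z*(\<kappa>*R0 + t1^2*t2*((1-Q)*S0)) -
    (N*(\<kappa>*R1 - t1*((1-T*Q)*S1)) - t1*B*F*(Q*(\<kappa>*R0) + t1*((1-Q)*S0))) =
    - (\<kappa>*M + (N*(s f2 - t1*Y*s f4) - t1*B*F*Q*(s f1 - t1*Y*s f3)
      - E*F*t1/z*(s f1 - t1*(t1*t2)*Q*Y*s f3)))"
    unfolding R0 R1 S0 S1 M_def g by (simp add: algebra_simps power2_eq_square)
  also have "\<dots> = 0" using main by simp
  finally show ?thesis by (simp add: mult.assoc)
qed

text \<open>Only linear algebra remains, so \<open>R0\<close>, \<open>R1\<close>, \<open>S0\<close>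
  and \<open>S1\<close> are arbitrary field elements.\<close>

lemma recurrence_from_contiguous_relation:
  fixes q Q t1 t2 t3 t4 z \<kappa> R0 R1 S0 S1 :: "'a::field"
  defines "T \<equiv> t1*t2*t3*t4"
  defines "N \<equiv> (1-t1*t2*Q)*(1-t1*t3*Q)*(1-t1*t4*Q)"
  defines "F \<equiv> 1 - t3*t4*Q" and "E \<equiv> 1 - T*Q^2"
  defines "B \<equiv> - t1 - t2 + t1*t2*(t3+t4)*Q"
  defines "D \<equiv> - 1 - t1*t2 + T*(Q/q) + t1*t2*Q"
  assumes nz: "z \<noteq> 0" "q \<noteq> 0" "t1 \<noteq> 0" "E \<noteq> 0" "F \<noteq> 0" "D \<noteq> 0"
    and rel: "E*F*t1/z*(\<kappa>*R0 + t1^2*t2*(1-Q)*S0) =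
      N*(\<kappa>*R1 - t1*(1-T*Q)*S1) - t1*B*F*(Q*\<kappa>*R0 + t1*(1-Q)*S0)"
  shows "1/z*(\<kappa>*R0 + t1^2*t2*(1-Q)*S0) =
    N/(t1*F*E)*(\<kappa>*R1 - t1*(1-T*Q)*S1) +
    B*(1-T*(Q^2/q))/(D*E)*(\<kappa>*R0 + t1^2*t2*(1-Q)*S0) +
    - ((1-Q)*(1-t1*t2*Q)*B/(D*E))*(\<kappa>*R0 - t1*(1-T*(Q/q))*S0)"
proof -
  define X where "X = \<kappa>*R0 + t1^2*t2*(1-Q)*S0"
  define X1 where "X1 = \<kappa>*R1 - t1*(1-T*Q)*S1"
  define V where "V = Q*\<kappa>*R0 + t1*(1-Q)*S0"
  define p where "p = Q/q"
  have p: "Q^2/q = Q*p" "Q/q = p" by (simp_all add: p_def power2_eq_square)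
  \<comment> \<open>In this combination the coefficients of \<open>\<kappa>*R0\<close> and
    \<open>S0\<close> are \<open>- Q*D\<close> and \<open>- t1*(1-Q)*D\<close>, so the denominator
    factor \<open>D\<close> cancels.\<close>
  have "(1-T*(Q*p))*X - (1-Q)*(1-t1*t2*Q)*(\<kappa>*R0 - t1*(1-T*p)*S0) = - D*V"
    unfolding X_def V_def D_def p by algebra
  then have "B/(D*E)*((1-T*(Q*p))*X - (1-Q)*(1-t1*t2*Q)*(\<kappa>*R0 - t1*(1-T*p)*S0)) =
      B/(D*E)*(- D*V)" by simp
  moreover have "B/(D*E)*(- D*V) = - B/E*V" using nz by simp
  ultimately have bc: "B*(1-T*(Q*p))/(D*E)*X + - ((1-Q)*(1-t1*t2*Q)*B/(D*E))*(\<kappa>*R0 - t1*(1-T*p)*S0)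
      = - B/E*V" by (simp add: algebra_simps diff_divide_distrib add_divide_distrib)
  have "1/z*X = (E*F*t1/z*X)/(t1*F*E)" using nz by simp
  also have "\<dots> = (N*X1 - t1*B*F*V)/(t1*F*E)"
    using rel unfolding X_def X1_def V_def by simp
  also have "\<dots> = N/(t1*F*E)*X1 + - B/E*V"
    using nz by (simp add: divide_simps)
  finally show ?thesis
    unfolding bc[symmetric] p X_def X1_def by (simp only: add.assoc)
qed

section \<open>Specialisation to Laurent series in z\<close>

theorem proposition4p8:
  fixes q t1 t2 t3 t4 :: real and n :: nat
  assumes "0 < q" and "q < 1"
    and "\<bar>t1\<bar> < 1" and "\<bar>t2\<bar> < 1" and "\<bar>t3\<bar> < 1" and "\<bar>t4\<bar> < 1"
    and "t1 \<noteq> 0"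
    and "- 1 - t1 * t2 + t1 * t2 * t3 * t4 * q ^ (n - 1) + t1 * t2 * q ^ n \<noteq> 0"
    and "n \<ge> 1"
  shows "1 / fls_X * AW_X q t1 t2 t3 t4 (int n) =
    fls_const (coeff_a q t1 t2 t3 t4 n) * AW_X q t1 t2 t3 t4 (- int n - 1) +
    fls_const (coeff_b q t1 t2 t3 t4 n) * AW_X q t1 t2 t3 t4 (int n) +
    fls_const (coeff_c q t1 t2 t3 t4 n) * AW_X q t1 t2 t3 t4 (- int n)"
proof -
  have prod_lt: "\<bar>x * y\<bar> < 1" if "\<bar>x\<bar> < 1" "\<bar>y\<bar> < 1" for x y :: real
    using mult_strict_mono'[OF that] by (simp add: abs_mult)
  \<comment> \<open>This bound keeps the lower symbols and the factors \<open>E\<close> and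
    \<open>F\<close> away from zero.\<close>
  have prod_ne: "x * q ^ k \<noteq> 1" if "\<bar>x\<bar> < 1" for x k
  proof -
    have "\<bar>x * q ^ k\<bar> \<le> \<bar>x\<bar> * 1"
      unfolding abs_mult by (intro mult_left_mono) (use assms in \<open>auto simp: power_le_one\<close>)
    with that show ?thesis by auto
  qed
  define Q where "Q = q ^ n"
  \<comment> \<open>All powers depending on n become rational in \<open>q\<close> and
    \<open>Q\<close>, matching the abstract lemmas; the truncated exponents are harmless since n is
    at least 1.\<close>
  have pow: "q ^ (n - 1) = Q / q" "q ^ (2*n - 1) = Q\<^sup>2 / q" "q ^ (2*n) = Q\<^sup>2" "q ^ Suc n = q * Q"
      "q powi (- int n) = 1 / Q" "q powi (int n - 1) = Q / q" "q powi (1 - int n) = q / Q"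
      "q powi (- int (Suc n)) = 1 / (q * Q)" "q powi (int (Suc n) - 1) = Q"
      "q powi (1 - int (Suc n)) = 1 / Q"
    using assms
    by (auto simp: Q_def power_diff power_mult power_int_minus power_int_diff divide_inverse
        mult.commute[of 2] power_mult_distrib)
  define c where "c = (fls_const :: real \<Rightarrow> real fls)"
  \<comment> \<open>The embedding of scalars is an injective field homomorphism, so formulas and
    inequations for reals carry over to \<open>real fls\<close>.\<close>
  have hom: "c (x * y) = c x * c y" "c (x + y) = c x + c y" "c (x - y) = c x - c y"
    "c (- x) = - c x" "c (x / y) = c x / c y" "c 1 = 1" "c (x ^ k) = c x ^ k" for x y k
    by (simp_all add: c_def fls_const_divide_const fls_const_power fls_plus_const fls_minus_const)
  have inj: "c x = c y \<longleftrightarrow> x = y" for x y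
    unfolding c_def by (auto dest: arg_cong[of _ _ "\<lambda>f. fls_nth f 0"])
  define \<kappa> where "\<kappa> = (1-c t1*c t2)*(1-c t1*c t3)*(1-c t1*c t4)"
  define T where "T = c t1*c t2*c t3*c t4"
  define R0 where "R0 = AW_R q t1 t2 t3 t4 n"
  define R1 where "R1 = AW_R q t1 t2 t3 t4 (Suc n)"
  define S0 where "S0 = AW_S q t1 t2 t3 t4 n"
  define S1 where "S1 = AW_S q t1 t2 t3 t4 (Suc n)"
  have nz: "fls_X \<noteq> (0 :: real fls)" "c Q \<noteq> 0" "c q \<noteq> 0" "c t1 \<noteq> 0"
    using assms inj[of _ 0] by (auto simp: c_def Q_def)
  have ne: "c q * c q ^ k \<noteq> 1" "c t1 * c t2 * c q ^ k \<noteq> 1" "c t1 * c t3 * c q ^ k \<noteq> 1"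
    "c t1 * c t4 * c q ^ k \<noteq> 1" for k
    unfolding hom(1,6,7)[symmetric] inj using assms by (auto intro!: prod_ne prod_lt)
  have "t1*t2*t3*t4*Q^2 \<noteq> 1" "t3*t4*Q \<noteq> 1"
    using assms prod_ne[of "t1*t2*t3*t4" "2*n"] prod_ne[of "t3*t4" n]
    by (auto intro!: prod_lt simp: pow(3) Q_def[symmetric])
  then have "c (1 - t1*t2*t3*t4*Q^2) \<noteq> c 0" "c (1 - t3*t4*Q) \<noteq> c 0"
    "c (- 1 - t1*t2 + t1*t2*t3*t4*(Q/q) + t1*t2*Q) \<noteq> c 0"
    unfolding inj using assms(8)[unfolded pow Q_def[symmetric]] by auto
  then have EFD: "1 - T*(c Q)^2 \<noteq> 0" "1 - c t3*c t4*c Q \<noteq> 0"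
    "- 1 - c t1*c t2 + T*(c Q/c q) + c t1*c t2*c Q \<noteq> 0"
    unfolding hom T_def by (simp_all add: c_def)
  have R: "R0 = phi43 (1/c Q) (T*c Q/c q) (c t1*fls_X) (c t1/fls_X)
        (c t1*c t2) (c t1*c t3) (c t1*c t4) (c q)"
      "R1 = phi43 (1/(c q*c Q)) (T*c Q) (c t1*fls_X) (c t1/fls_X)
        (c t1*c t2) (c t1*c t3) (c t1*c t4) (c q)"
    unfolding R0_def R1_def AW_R_def pow c_def[symmetric] T_def hom by simp_all
  have S: "S0 = fls_X*(1-c t3/fls_X)*(1-c t4/fls_X) *
        phi43 (c q/c Q) (T*c Q) (c t1*fls_X) (c q*c t1/fls_X)
        (c q*c t1*c t2) (c q*c t1*c t3) (c q*c t1*c t4) (c q)"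
      "S1 = fls_X*(1-c t3/fls_X)*(1-c t4/fls_X) *
        phi43 (1/c Q) (T*(c q*c Q)) (c t1*fls_X) (c q*c t1/fls_X)
        (c q*c t1*c t2) (c q*c t1*c t3) (c q*c t1*c t4) (c q)"
    unfolding S0_def S1_def AW_S_def pow Q_def[symmetric] c_def[symmetric] T_def hom
    using assms by simp_all
  have Q: "c Q = c q ^ n" by (simp add: Q_def hom)
  note rel = contiguous_relation[OF nz(1-3) ne Q \<open>n \<ge> 1\<close>, folded T_def, folded \<kappa>_def R S]
  note rec = recurrence_from_contiguous_relation[OF nz(1) nz(3) nz(4) EFD[unfolded T_def] rel[unfolded T_def],
      folded T_def]
  have X: "AW_X q t1 t2 t3 t4 (int n) = \<kappa>*R0 + (c t1)^2*c t2*(1-c Q)*S0"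
      "AW_X q t1 t2 t3 t4 (- int n) = \<kappa>*R0 - c t1*(1-T*(c Q/c q))*S0"
      "AW_X q t1 t2 t3 t4 (- int n - 1) = \<kappa>*R1 - c t1*(1-T*c Q)*S1"
  proof -
    \<comment> \<open>At index -n-1 the degree is n+1, so the exponent \<open>n - 1\<close> in
      \<open>AW_X_def\<close> becomes n.\<close>
    have *: "nat \<bar>- int n - 1\<bar> = Suc n" "Suc n - 1 = n" by simp_all
    show "AW_X q t1 t2 t3 t4 (int n) = \<kappa>*R0 + (c t1)^2*c t2*(1-c Q)*S0"
      by (simp add: AW_X_def Let_def R0_def S0_def c_def[symmetric] hom \<kappa>_def Q)
    show "AW_X q t1 t2 t3 t4 (- int n) = \<kappa>*R0 - c t1*(1-T*(c Q/c q))*S0"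
    proof -
      have "c Q / c q = c q ^ (n - 1)"
        by (simp only: pow(1) hom(5,7)[symmetric])
      then show ?thesis
        using \<open>n \<ge> 1\<close>
        by (simp add: AW_X_def Let_def R0_def S0_def c_def[symmetric] hom \<kappa>_def T_def)
    qed
    show "AW_X q t1 t2 t3 t4 (- int n - 1) = \<kappa>*R1 - c t1*(1-T*c Q)*S1"
      unfolding AW_X_def Let_def *
      by (simp add: R1_def S1_def c_def[symmetric] hom \<kappa>_def T_def Q)
  qed
  have coeff: "c (coeff_a q t1 t2 t3 t4 n) =
      (1-c t1*c t2*c Q)*(1-c t1*c t3*c Q)*(1-c t1*c t4*c Q)/(c t1*(1-c t3*c t4*c Q)*(1-T*(c Q)^2))"
    "c (coeff_b q t1 t2 t3 t4 n) =
      (- c t1 - c t2 + c t1*c t2*(c t3+c t4)*c Q)*(1-T*((c Q)^2/c q))/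
      ((- 1 - c t1*c t2 + T*(c Q/c q) + c t1*c t2*c Q)*(1-T*(c Q)^2))"
    "c (coeff_c q t1 t2 t3 t4 n) =
      - ((1-c Q)*(1-c t1*c t2*c Q)*(- c t1 - c t2 + c t1*c t2*(c t3+c t4)*c Q)/
      ((- 1 - c t1*c t2 + T*(c Q/c q) + c t1*c t2*c Q)*(1-T*(c Q)^2)))"
    unfolding coeff_a_def coeff_b_def coeff_c_def pow Q_def[symmetric] T_def hom by simp_all
  show ?thesis
    unfolding c_def[symmetric] X coeff by (rule rec)
qed

end
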